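(* Let $R$ be a left principal ideal domain and let $\sigma$ be an endomorphism of $R$. If $\sigma(R)$ contains a nonzero left ideal $L$ of $R$, then $\sigma$ is an automorphism of $R$.
   Context: Rings are associative with unity. A left principal ideal domain is a (not necessarily commutative) domain in which every left ideal is principal, i.e. of the form $Ra$. *)

theory Defs
  imports "HOL-Algebra.QuotRing"
begin

locale left_ideal = additive_subgroup I R + ring R for I and R (structure) +
  assumes l_closed: "\<lbrakk>a \<in> I; x \<in> carrier R\<rbrakk> \<Longrightarrow> x \<otimes> a \<in> I"

text \<open>The library locale \<open>domain\<close> extends \<open>cring\<close>; here multiplication need not commute.\<close>

locale nc_domain = ring +
  assumes one_not_zero: "\<one> \<noteq> \<zero>"
    and no_zero_divisors:
      "\<lbrakk>a \<otimes> b = \<zero>; a \<in> carrier R; b \<in> carrier R\<rbrakk> \<Longrightarrow> a = \<zero> \<or> b = \<zero>"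

text \<open>\<open>PIdl a\<close> is the set \<open>{x \<otimes> a | x. x \<in> carrier R}\<close>, i.e. the left ideal \<open>Ra\<close> also in the
  noncommutative case.\<close>

locale left_principal_ideal_domain = nc_domain +
  assumes left_principal: "left_ideal I R \<Longrightarrow> \<exists>a \<in> carrier R. I = PIdl a"

end

theory Submission
  imports Defs
begin

text \<open>Write \<open>S = \<sigma>(R)\<close>. The preimage of \<open>L\<close> under \<open>\<sigma>\<close> is a left ideal of \<open>R\<close>, hence of the form
  \<open>Rd\<close>; since \<open>L \<subseteq> S\<close>, applying \<open>\<sigma>\<close> gives \<open>L = Sc\<close> with \<open>c = \<sigma>(d)\<close>, and \<open>c \<noteq> 0\<close>. But \<open>L\<close> is also a
  left ideal of \<open>R\<close>, so \<open>Rc \<subseteq> L = Sc\<close>, and cancelling \<open>c\<close> yields \<open>R = S\<close>. Thus \<open>\<sigma>\<close> is surjective.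

  A surjective endomorphism is injective by the usual Noetherian argument: the kernels of the
  powers of \<open>\<sigma>\<close> form an ascending chain whose union is a left ideal, and a generator of the union
  already lies in some \<open>ker \<sigma>\<^sup>n\<close>. If \<open>\<sigma>(x) = 0\<close> and \<open>x = \<sigma>\<^sup>n(y)\<close>, then \<open>y\<close> lies in
  \<open>ker \<sigma>\<^sup>n\<^sup>+\<^sup>1 = ker \<sigma>\<^sup>n\<close>, so \<open>x = 0\<close>.\<close>

text \<open>Closure under negation comes for free, since \<open>\<ominus>a = (\<ominus>\<one>) \<otimes> a\<close>.\<close>

lemma (in ring) left_idealI:
  assumes sub: "I \<subseteq> carrier R"
    and zero: "\<zero> \<in> I"
    and add: "\<And>a b. \<lbrakk>a \<in> I; b \<in> I\<rbrakk> \<Longrightarrow> a \<oplus> b \<in> I"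
    and mult: "\<And>a x. \<lbrakk>a \<in> I; x \<in> carrier R\<rbrakk> \<Longrightarrow> x \<otimes> a \<in> I"
  shows "left_ideal I R"
proof -
  have "\<ominus> a \<in> I" if "a \<in> I" for a
  proof -
    have "\<ominus> a = (\<ominus> \<one>) \<otimes> a"
      using that sub by (auto simp: l_minus)
    then show ?thesis
      using mult[OF that, of "\<ominus> \<one>"] by simp
  qed
  then have "subgroup I (add_monoid R)"
    using sub zero add by unfold_locales (auto simp: a_inv_def)
  then have "additive_subgroup I R"
    by (rule additive_subgroup.intro)
  then show ?thesis
    using mult ring_axioms by (intro left_ideal.intro left_ideal_axioms.intro) auto
qed

lemma (in nc_domain) mult_right_cancel:
  assumes "a \<in> carrier R" "b \<in> carrier R" "c \<in> carrier R"
    and "c \<noteq> \<zero>" and "a \<otimes> c = b \<otimes> c"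
  shows "a = b"
proof -
  have "(a \<ominus> b) \<otimes> c = \<zero>"
    using assms by (simp add: minus_eq l_distr l_minus r_neg)
  then have "a \<ominus> b = \<zero>"
    using no_zero_divisors assms by blast
  then show ?thesis
    using assms(1,2) by (metis minus_eq a_inv_closed minus_equality minus_minus)
qed

lemma (in ring) left_ideal_vimage:
  assumes hom: "\<sigma> \<in> ring_hom R R" and "left_ideal L R"
  shows "left_ideal {x \<in> carrier R. \<sigma> x \<in> L} R"
proof -
  interpret L: left_ideal L R by fact
  show ?thesis
    using ring_hom_zero[OF hom ring_axioms ring_axioms]
    by (intro left_idealI)
      (auto simp: ring_hom_add[OF hom] ring_hom_mult[OF hom] L.l_closed ring_hom_closed[OF hom])
qed

text \<open>\<open>L\<close> is generated over \<open>\<sigma>(R)\<close> by a single element \<open>c\<close>, and it absorbs multiplication by all of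
  \<open>R\<close>; as \<open>c\<close> can be cancelled, this leaves no room between \<open>\<sigma>(R)\<close> and \<open>R\<close>.\<close>

lemma (in left_principal_ideal_domain) endomorphism_surjective_if_image_contains_left_ideal:
  assumes hom: "\<sigma> \<in> ring_hom R R"
    and L: "left_ideal L R" "L \<noteq> {\<zero>}" "L \<subseteq> \<sigma> ` carrier R"
  shows "\<sigma> ` carrier R = carrier R"
proof
  interpret L: left_ideal L R by fact
  show "\<sigma> ` carrier R \<subseteq> carrier R"
    using ring_hom_closed[OF hom] by auto
  obtain d where d: "d \<in> carrier R" and vimage: "{x \<in> carrier R. \<sigma> x \<in> L} = PIdl d"
    using left_principal[OF left_ideal_vimage[OF hom L(1)]] by blast
  define c where "c = \<sigma> d"
  have c: "c \<in> carrier R"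
    using d ring_hom_closed[OF hom] by (simp add: c_def)
  have "d \<in> PIdl d"
    using d unfolding cgenideal_def by (auto intro!: exI[of _ \<one>])
  then have "c \<in> L"
    using vimage by (auto simp: c_def)
  have generates: "\<exists>s \<in> \<sigma> ` carrier R. l = s \<otimes> c" if l: "l \<in> L" for l
  proof -
    obtain x where x: "x \<in> carrier R" "l = \<sigma> x"
      using l L(3) by blast
    then have "x \<in> PIdl d"
      using l vimage by blast
    then obtain r where "r \<in> carrier R" "x = r \<otimes> d"
      unfolding cgenideal_def by blast
    then show ?thesis
      using x d ring_hom_mult[OF hom] by (auto simp: c_def)
  qed
  have "c \<noteq> \<zero>"
  proof
    assume "c = \<zero>"
    then have "L \<subseteq> {\<zero>}"
      using generates ring_hom_closed[OF hom] by fastforce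
    then show False
      using L(2) L.zero_closed by blast
  qed
  show "carrier R \<subseteq> \<sigma> ` carrier R"
  proof
    fix r assume r: "r \<in> carrier R"
    then obtain s where s: "s \<in> \<sigma> ` carrier R" "r \<otimes> c = s \<otimes> c"
      using generates L.l_closed[OF \<open>c \<in> L\<close>] by blast
    moreover have "s \<in> carrier R"
      using s(1) ring_hom_closed[OF hom] by auto
    ultimately have "r = s"
      using mult_right_cancel[OF r _ c \<open>c \<noteq> \<zero>\<close>] by blast
    then show "r \<in> \<sigma> ` carrier R"
      using s(1) by simp
  qed
qed

lemma (in ring) funpow_ring_hom:
  assumes "\<sigma> \<in> ring_hom R R"
  shows "\<sigma> ^^ n \<in> ring_hom R R"
proof (induction n)
  case 0
  show ?case by (simp add: ring_hom_def)
next
  case (Suc n)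
  then show ?case using ring_hom_trans[OF Suc assms] by (simp add: comp_def)
qed

lemma (in ring) funpow_eq_zero_mono:
  assumes hom: "\<sigma> \<in> ring_hom R R" and "(\<sigma> ^^ m) x = \<zero>" and "m \<le> n"
  shows "(\<sigma> ^^ n) x = \<zero>"
proof -
  have "(\<sigma> ^^ n) x = (\<sigma> ^^ (n - m)) ((\<sigma> ^^ m) x)"
    using funpow_add[of "n - m" m \<sigma>] \<open>m \<le> n\<close> by simp
  then show ?thesis
    using assms(2) ring_hom_zero[OF funpow_ring_hom[OF hom] ring_axioms ring_axioms] by simp
qed

text \<open>The union of the kernels is closed under addition because the kernels form a chain.\<close>

lemma (in ring) left_ideal_Union_kernels:
  assumes hom: "\<sigma> \<in> ring_hom R R"
  shows "left_ideal {x \<in> carrier R. \<exists>n. (\<sigma> ^^ n) x = \<zero>} R"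
proof (rule left_idealI)
  let ?K = "{x \<in> carrier R. \<exists>n. (\<sigma> ^^ n) x = \<zero>}"
  note pow = funpow_ring_hom[OF hom]
  show "?K \<subseteq> carrier R" by blast
  show "\<zero> \<in> ?K"
    using ring_hom_zero[OF pow ring_axioms ring_axioms] by simp
  show "a \<oplus> b \<in> ?K" if ab: "a \<in> ?K" "b \<in> ?K" for a b
  proof -
    obtain m n where "(\<sigma> ^^ m) a = \<zero>" "(\<sigma> ^^ n) b = \<zero>"
      using ab by blast
    then have "(\<sigma> ^^ max m n) a = \<zero>" "(\<sigma> ^^ max m n) b = \<zero>"
      using funpow_eq_zero_mono[OF hom] by (meson max.cobounded1 max.cobounded2)+
    then have "(\<sigma> ^^ max m n) (a \<oplus> b) = \<zero>"
      using ab by (simp add: ring_hom_add[OF pow])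
    then show ?thesis
      using ab by blast
  qed
  show "x \<otimes> a \<in> ?K" if ax: "a \<in> ?K" "x \<in> carrier R" for a x
  proof -
    obtain n where "(\<sigma> ^^ n) a = \<zero>"
      using ax by blast
    then have "(\<sigma> ^^ n) (x \<otimes> a) = \<zero>"
      using ax by (simp add: ring_hom_mult[OF pow] ring_hom_closed[OF pow])
    then show ?thesis
      using ax by blast
  qed
qed

text \<open>If a power \<open>\<sigma>\<^sup>n\<close> kills a generator of the union of the kernels, it kills the whole union, so the
  chain of kernels is constant from \<open>n\<close> on.\<close>

lemma (in left_principal_ideal_domain) kernels_stabilise:
  assumes hom: "\<sigma> \<in> ring_hom R R"
  obtains n where "\<And>x m. \<lbrakk>x \<in> carrier R; (\<sigma> ^^ m) x = \<zero>\<rbrakk> \<Longrightarrow> (\<sigma> ^^ n) x = \<zero>"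
proof -
  let ?K = "{x \<in> carrier R. \<exists>n. (\<sigma> ^^ n) x = \<zero>}"
  note pow = funpow_ring_hom[OF hom]
  obtain a where a: "a \<in> carrier R" and K: "?K = PIdl a"
    using left_principal[OF left_ideal_Union_kernels[OF hom]] by blast
  have "a \<in> PIdl a"
    using a unfolding cgenideal_def by (auto intro!: exI[of _ \<one>])
  then obtain n where n: "(\<sigma> ^^ n) a = \<zero>"
    using K by blast
  show thesis
  proof
    fix x m
    assume "x \<in> carrier R" "(\<sigma> ^^ m) x = \<zero>"
    then have "x \<in> PIdl a"
      using K by blast
    then obtain r where "r \<in> carrier R" "x = r \<otimes> a"
      unfolding cgenideal_def by blast
    then show "(\<sigma> ^^ n) x = \<zero>"
      using a n by (simp add: ring_hom_mult[OF pow] ring_hom_closed[OF pow])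
  qed
qed

lemma (in left_principal_ideal_domain) surjective_endomorphism_inj_on:
  assumes hom: "\<sigma> \<in> ring_hom R R" and surj: "\<sigma> ` carrier R = carrier R"
  shows "inj_on \<sigma> (carrier R)"
proof -
  obtain n where n: "\<And>x m. \<lbrakk>x \<in> carrier R; (\<sigma> ^^ m) x = \<zero>\<rbrakk> \<Longrightarrow> (\<sigma> ^^ n) x = \<zero>"
    using kernels_stabilise[OF hom] by blast
  have surj_pow: "(\<sigma> ^^ k) ` carrier R = carrier R" for k
  proof (induction k)
    case (Suc k)
    have "(\<sigma> ^^ Suc k) ` carrier R = \<sigma> ` ((\<sigma> ^^ k) ` carrier R)"
      by (simp only: funpow.simps image_comp)
    then show ?case
      by (simp only: Suc.IH surj)
  qed simp
  have kernel_trivial: "x = \<zero>" if x: "x \<in> carrier R" "\<sigma> x = \<zero>" for x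
  proof -
    obtain y where y: "y \<in> carrier R" "x = (\<sigma> ^^ n) y"
      using x(1) surj_pow[of n] by blast
    then have "(\<sigma> ^^ Suc n) y = \<zero>"
      using x(2) by simp
    then show ?thesis
      using n y by blast
  qed
  interpret ring_hom_ring R R \<sigma>
    using ring_hom_ringI2[OF ring_axioms ring_axioms hom] .
  have "a_kernel R R \<sigma> = {\<zero>}"
    unfolding a_kernel_def' using kernel_trivial zero_closed hom_zero by blast
  then show ?thesis
    by (rule trivial_ker_imp_inj)
qed

theorem theorem2p8:
  fixes R :: "('a, 'm) ring_scheme" (structure)
    and \<sigma> :: "'a \<Rightarrow> 'a"
    and L :: "'a set"
  assumes "left_principal_ideal_domain R"
    and "\<sigma> \<in> ring_hom R R"
    and "left_ideal L R"
    and "L \<noteq> {\<zero>}"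
    and "L \<subseteq> \<sigma> ` carrier R"
  shows "\<sigma> \<in> ring_iso R R"
proof -
  interpret left_principal_ideal_domain R by fact
  have surj: "\<sigma> ` carrier R = carrier R"
    using endomorphism_surjective_if_image_contains_left_ideal assms(2-5) .
  moreover have "inj_on \<sigma> (carrier R)"
    using surjective_endomorphism_inj_on assms(2) surj .
  ultimately show ?thesis
    using assms(2) by (simp add: ring_iso_def bij_betw_def)
qed

end
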